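(* We have $\alpha(11)=\frac{53}{10}$.
   Context: A simplicial complex is a non-empty finite set $\mathcal{S}$ of finite sets that is closed under taking subsets, i.e. $S'\subseteq S\in\mathcal{S}$ implies $S'\in\mathcal{S}$ (so $\varnothing\in\mathcal{S}$ always, and $\varnothing$ is counted in $|\mathcal{S}|$). Its vertex set is $V(\mathcal{S})=\bigcup_{S\in\mathcal{S}}S$. The degree of $x\in V(\mathcal{S})$ is $d(x)=|\{e\in\mathcal{S}: x\in e\}|$ (the singleton $\{x\}$ is counted), and the minimum degree is $\delta(\mathcal{S})=\min\{d(x): x\in V(\mathcal{S})\}$, with $\delta(\{\varnothing\})=\infty$. For an integer $d\geq 0$, $\alpha(d)$ denotes the largest real number such that every simplicial complex $\mathcal{S}$ with $|\mathcal{S}|\leq\alpha(d)\,|V(\mathcal{S})|$ satisfies $\delta(\mathcal{S})\leq d$. (This maximum exists for every integer $d\ge 0$.) *)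

theory Defs
  imports Complex_Main "HOL-Library.Extended_Nat"
begin

definition simplicial_complex :: "'a set set \<Rightarrow> bool" where
  "simplicial_complex S \<longleftrightarrow>
     S \<noteq> {} \<and> finite S \<and> (\<forall>A\<in>S. finite A) \<and> (\<forall>A\<in>S. \<forall>B. B \<subseteq> A \<longrightarrow> B \<in> S)"

definition vertices :: "'a set set \<Rightarrow> 'a set" where
  "vertices S = \<Union>S"

definition vertex_degree :: "'a set set \<Rightarrow> 'a \<Rightarrow> nat" where
  "vertex_degree S x = card {e \<in> S. x \<in> e}"

text \<open>
  The infimum in \<^typ>\<open>enat\<close> is a minimum when there is at least one vertex, and it is
  \<open>\<infinity>\<close> when there is none.
\<close>
definition min_degree :: "'a set set \<Rightarrow> enat" where
  "min_degree S = (INF x\<in>vertices S. enat (vertex_degree S x))"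

text \<open>
  A real constant cannot quantify over all vertex types, so vertices are taken to be natural
  numbers. Nothing is lost: by \<open>alpha_bound_any_type\<close> below, the condition on complexes with
  vertices in \<^typ>\<open>nat\<close> implies the same condition for every other type of vertices.
\<close>
definition alpha_bound :: "nat \<Rightarrow> real \<Rightarrow> bool" where
  "alpha_bound d a \<longleftrightarrow>
     (\<forall>S :: nat set set. simplicial_complex S \<longrightarrow>
        real (card S) \<le> a * real (card (vertices S)) \<longrightarrow> min_degree S \<le> enat d)"

definition alpha :: "nat \<Rightarrow> real" where
  "alpha d = (GREATEST a. alpha_bound d a)"

lemma min_degree_no_vertices: "min_degree {{}} = \<infinity>"
  by (simp add: min_degree_def vertices_def top_enat_def)

lemma min_degree_eq_Min:
  assumes "simplicial_complex S" "vertices S \<noteq> {}"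
  shows "min_degree S = enat (Min (vertex_degree S ` vertices S))"
proof -
  have fin: "finite (vertex_degree S ` vertices S)"
    using assms(1) by (auto simp: simplicial_complex_def vertices_def)
  have "Min (vertex_degree S ` vertices S) \<in> vertex_degree S ` vertices S"
    using fin assms(2) by (intro Min_in) auto
  then show ?thesis
    unfolding min_degree_def using fin
    by (intro antisym INF_greatest) (auto intro: INF_lower)
qed

lemma simplicial_complex_nat_copy:
  fixes S :: "'a set set"
  assumes S: "simplicial_complex S"
  obtains T :: "nat set set" where "simplicial_complex T" "card T = card S"
    "card (vertices T) = card (vertices S)" "min_degree T = min_degree S"
proof -
  have "finite (vertices S)"
    using S by (auto simp: simplicial_complex_def vertices_def)
  then obtain f :: "'a \<Rightarrow> nat" where f: "inj_on f (vertices S)"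
    using finite_imp_inj_to_nat_seg by metis
  define T where "T = (`) f ` S"
  have sub: "A \<subseteq> vertices S" if "A \<in> S" for A
    using that by (auto simp: vertices_def)
  have inj: "inj_on ((`) f) S"
    by (rule inj_on_subset[OF inj_on_image_Pow[OF f]]) (use sub in auto)
  have V: "vertices T = f ` vertices S"
    by (auto simp: T_def vertices_def)
  have "simplicial_complex T"
    using S by (auto simp: simplicial_complex_def T_def subset_image_iff)
  moreover have "card T = card S"
    unfolding T_def using inj by (rule card_image)
  moreover have "card (vertices T) = card (vertices S)"
    unfolding V using f by (rule card_image)
  moreover have "vertex_degree T (f x) = vertex_degree S x" if x: "x \<in> vertices S" for x
  proof -
    have "{e \<in> T. f x \<in> e} = (`) f ` {e \<in> S. x \<in> e}"
    proof -
      have "f x \<in> f ` A \<longleftrightarrow> x \<in> A" if "A \<in> S" for A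
        using inj_on_image_mem_iff[OF f x sub[OF that]] .
      then show ?thesis
        unfolding T_def by blast
    qed
    then show ?thesis
      unfolding vertex_degree_def by (simp add: card_image inj_on_subset[OF inj])
  qed
  then have "min_degree T = min_degree S"
    unfolding min_degree_def V image_image by (simp cong: image_cong)
  ultimately show ?thesis by (rule that)
qed

lemma alpha_bound_any_type:
  fixes S :: "'a set set"
  assumes "alpha_bound d a" "simplicial_complex S"
    "real (card S) \<le> a * real (card (vertices S))"
  shows "min_degree S \<le> enat d"
  using assms by (metis alpha_bound_def simplicial_complex_nat_copy)

end

theory Submission
  imports Defs
begin

text \<open>
  Suppose that all degrees are at least \<open>12\<close>. Sharing every nonempty face equally among its
  vertices gives a vertex lying in \<open>v\<close>, \<open>e\<close>, \<open>t\<close> faces of size \<open>2\<close>, \<open>3\<close>, \<open>4\<close> at least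
  \<open>1 + v/2 + e/3 + t/4\<close>; multiplied by \<open>60\<close>, the average has to be at least \<open>318\<close>. Only two
  links with \<open>12\<close> or more faces fall short: the one with facets \<open>abc, abd\<close> (type A, by \<open>8\<close>) and the one
  with facets \<open>abc, ad, bd, cd\<close> (type B, by \<open>3\<close>). A discharging argument makes their neighbours
  pay: a vertex of type A gets \<open>4\<close> from each of \<open>a\<close>, \<open>b\<close> that is not of type A, and for each of
  \<open>a\<close>, \<open>b\<close> that is of type A it gets \<open>2\<close> from each of \<open>c\<close>, \<open>d\<close>; a vertex of type B gets \<open>3\<close> from
  \<open>d\<close>, or \<open>1\<close> from each of \<open>a\<close>, \<open>b\<close>, \<open>c\<close> if \<open>d\<close> is of type B too.

  Conversely, take all sets of at most three out of five points together with one set of size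
  four. Only the point outside the latter has degree \<open>11\<close>; joining two such complexes by an edge
  between these points repairs this and yields \<open>53\<close> nonempty faces on \<open>10\<close> vertices. Disjoint
  copies share the empty face, so the ratio tends to \<open>53/10\<close>.
\<close>

section \<open>Counting the faces at a vertex and at an edge\<close>

lemma card_subsets_containing:
  assumes "finite G" "x \<in> G"
  shows "card {F. F \<subseteq> G \<and> x \<in> F \<and> card F = Suc k} = (card G - 1) choose k"
proof -
  have "{F. F \<subseteq> G \<and> x \<in> F \<and> card F = Suc k} = insert x ` {P. P \<subseteq> G - {x} \<and> card P = k}"
  proof (intro equalityI subsetI)
    fix F assume F: "F \<in> {F. F \<subseteq> G \<and> x \<in> F \<and> card F = Suc k}"
    then have "F - {x} \<in> {P. P \<subseteq> G - {x} \<and> card P = k}" "F = insert x (F - {x})"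
      using finite_subset[OF _ assms(1)] by auto
    then show "F \<in> insert x ` {P. P \<subseteq> G - {x} \<and> card P = k}" by blast
  next
    fix F assume "F \<in> insert x ` {P. P \<subseteq> G - {x} \<and> card P = k}"
    then obtain P where "F = insert x P" "P \<subseteq> G - {x}" "card P = k" by auto
    moreover from this have "finite P" using finite_subset assms(1) by blast
    ultimately show "F \<in> {F. F \<subseteq> G \<and> x \<in> F \<and> card F = Suc k}"
      using assms by (auto simp: card_insert_if)
  qed
  moreover have "inj_on (insert x) {P. P \<subseteq> G - {x} \<and> card P = k}"
    by (rule inj_onI) (use insert_ident in blast)
  ultimately show ?thesis
    using assms by (simp add: card_image n_subsets)
qed

text \<open>Once the faces at a vertex are listed without repetition, every face count there becomes
  the length of a filtered list, which the simplifier evaluates.\<close>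

lemma card_Collect_filter:
  assumes "{F \<in> X. Q F} = set xs" "distinct xs"
  shows "card {F \<in> X. Q F \<and> P F} = length (filter P xs)"
proof -
  have "{F \<in> X. Q F \<and> P F} = set (filter P xs)" using assms(1) by auto
  then show ?thesis using assms(2) by (metis distinct_card distinct_filter)
qed

text \<open>The complex \<open>{{}}\<close> satisfies the degree condition vacuously, in accordance
  with its minimum degree \<infinity>.\<close>

locale min_degree_12 =
  fixes S :: "'a set set"
  assumes complex: "simplicial_complex S"
    and degree_ge: "x \<in> vertices S \<Longrightarrow> 12 \<le> vertex_degree S x"
begin

lemma finite_S: "finite S" and finite_face: "F \<in> S \<Longrightarrow> finite F"
  and face_subset: "F \<in> S \<Longrightarrow> G \<subseteq> F \<Longrightarrow> G \<in> S"
  using complex by (auto simp: simplicial_complex_def)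

lemma finite_vertices: "finite (vertices S)"
  using finite_S finite_face by (auto simp: vertices_def)

definition nb :: "'a \<Rightarrow> 'a set" where
  "nb x = {y. y \<noteq> x \<and> {x, y} \<in> S}"

definition star :: "nat \<Rightarrow> 'a \<Rightarrow> 'a set set" where
  "star k x = {F \<in> S. x \<in> F \<and> card F = k}"

text \<open>For a neighbour \<open>y\<close> of \<open>x\<close>, \<open>codeg 3 x y\<close> is the
  number of edges and \<open>codeg 4 x y\<close> the number of triangles at \<open>y\<close> in the
  link of \<open>x\<close>. Being symmetric, these numbers can be read from either end of a
  payment.\<close>

definition codeg :: "nat \<Rightarrow> 'a \<Rightarrow> 'a \<Rightarrow> nat" where
  "codeg k x y = card {F \<in> S. x \<in> F \<and> y \<in> F \<and> card F = k}"

lemma codeg_commute: "codeg k x y = codeg k y x"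
  unfolding codeg_def by (rule arg_cong[where f = card]) auto

lemma finite_star [simp]: "finite (star k x)"
  using finite_S by (simp add: star_def)

lemma nb_subset: "nb x \<subseteq> vertices S"
  by (auto simp: nb_def vertices_def)

lemma finite_nb [simp]: "finite (nb x)"
  using nb_subset finite_vertices finite_subset by blast

lemma self_notin_nb [simp]: "x \<notin> nb x"
  by (simp add: nb_def)

lemma nb_sym: "y \<in> nb x \<longleftrightarrow> x \<in> nb y"
  by (auto simp: nb_def insert_commute)

lemma nbI: "F \<in> S \<Longrightarrow> x \<in> F \<Longrightarrow> y \<in> F \<Longrightarrow> y \<noteq> x \<Longrightarrow> y \<in> nb x"
  unfolding nb_def using face_subset[of F "{x, y}"] by auto

lemma face_subset_nb: "F \<in> S \<Longrightarrow> x \<in> F \<Longrightarrow> F \<subseteq> insert x (nb x)"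
  using nbI by blast

lemma star_subset: "star k x \<subseteq> {F. F \<subseteq> insert x (nb x) \<and> x \<in> F \<and> card F = k}"
  using face_subset_nb by (auto simp: star_def)

lemma finite_link_sets [simp]: "finite {F. F \<subseteq> insert x (nb x) \<and> P F}"
  by (rule finite_subset[of _ "Pow (insert x (nb x))"]) auto

lemma card_star_le: "card (star (Suc k) x) \<le> card (nb x) choose k"
  using card_mono[OF finite_link_sets star_subset, of "Suc k" x]
    card_subsets_containing[of "insert x (nb x)" x k] by simp

text \<open>A face of size 3 on the edge \<open>xy\<close> is determined by its third vertex, a
  neighbour of \<open>x\<close> other than \<open>y\<close>.\<close>

lemma codeg3_le: "codeg 3 x y \<le> card (nb x) - 1" if "y \<in> nb x"
proof -
  have "{F \<in> S. x \<in> F \<and> y \<in> F \<and> card F = 3} \<subseteq> (\<lambda>z. {x, y, z}) ` (nb x - {y})"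
  proof
    fix F assume F: "F \<in> {F \<in> S. x \<in> F \<and> y \<in> F \<and> card F = 3}"
    then have fin: "finite F" using finite_face by auto
    have xy: "x \<noteq> y" using that by auto
    have "card (F - {x, y}) = 1" using F xy fin by (simp add: card_Diff_subset)
    then obtain z where z: "F - {x, y} = {z}" by (auto simp: card_1_singleton_iff)
    then have "F = {x, y, z}" "z \<noteq> x" "z \<noteq> y" "z \<in> F" using F by auto
    moreover have "z \<in> nb x" using nbI[of F x z] F calculation by auto
    ultimately show "F \<in> (\<lambda>z. {x, y, z}) ` (nb x - {y})" by blast
  qed
  then have "codeg 3 x y \<le> card ((\<lambda>z. {x, y, z}) ` (nb x - {y}))"
    unfolding codeg_def by (intro card_mono) auto
  also have "\<dots> \<le> card (nb x - {y})" by (rule card_image_le) auto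
  finally show ?thesis using that by simp
qed

lemma codeg_le_star: "codeg k x y \<le> card (star k x)"
  unfolding codeg_def star_def using finite_S by (intro card_mono) auto

lemma codeg_pos: "F \<in> S \<Longrightarrow> x \<in> F \<Longrightarrow> y \<in> F \<Longrightarrow> card F = k \<Longrightarrow> 0 < codeg k x y"
  unfolding codeg_def using finite_S by (subst card_gt_0_iff) auto

text \<open>Handshake count in the link: a face of size \<open>Suc k\<close> through
  \<open>x\<close> is counted once for each of its \<open>k\<close> other vertices.\<close>

lemma sum_codeg: "(\<Sum>y\<in>nb x. codeg (Suc k) x y) = k * card (star (Suc k) x)"
proof -
  have "(\<Sum>y\<in>nb x. card {F \<in> star (Suc k) x. y \<in> F}) = (\<Sum>F\<in>star (Suc k) x. k)"
  proof (rule sum_multicount_gen)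
    have "card {y \<in> nb x. y \<in> F} = k" if "F \<in> star (Suc k) x" for F
    proof -
      have F: "F \<in> S" "x \<in> F" "card F = Suc k" using that by (auto simp: star_def)
      have "{y \<in> nb x. y \<in> F} = F - {x}" using face_subset_nb[OF F(1,2)] by auto
      then show ?thesis using F finite_face by simp
    qed
    then show "\<forall>F\<in>star (Suc k) x. card {y \<in> nb x. y \<in> F} = k" by simp
  qed auto
  moreover have "{F \<in> star (Suc k) x. y \<in> F} = {F \<in> S. x \<in> F \<and> y \<in> F \<and> card F = Suc k}" for y
    by (auto simp: star_def)
  ultimately show ?thesis by (simp add: codeg_def)
qed

lemma sum_codeg3: "(\<Sum>y\<in>nb x. codeg 3 x y) = 2 * card (star 3 x)"
  using sum_codeg[of 2 x] by (simp add: eval_nat_numeral)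

lemma sum_codeg4: "(\<Sum>y\<in>nb x. codeg 4 x y) = 3 * card (star 4 x)"
  using sum_codeg[of 3 x] by (simp add: eval_nat_numeral)

lemma card_star2: "card (star 2 x) = card (nb x)"
proof -
  have "star 2 x = (\<lambda>y. {x, y}) ` nb x"
    by (auto simp: star_def nb_def card_2_iff doubleton_eq_iff insert_commute)
  moreover have "inj_on (\<lambda>y. {x, y}) (nb x)"
    by (auto simp: inj_on_def doubleton_eq_iff)
  ultimately show ?thesis by (simp add: card_image)
qed

lemma subfaces_star:
  assumes "G \<in> S" "x \<in> G"
  shows "{F. F \<subseteq> G \<and> x \<in> F \<and> card F = k} \<subseteq> star k x"
  using face_subset[OF assms(1)] by (auto simp: star_def)

lemma star_ge:
  assumes "G \<in> S" "x \<in> G"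
  shows "(card G - 1) choose k \<le> card (star (Suc k) x)"
  using card_mono[OF finite_star subfaces_star[OF assms]]
    card_subsets_containing[OF finite_face[OF assms(1)] assms(2)] by metis

lemma star3_ge_3:
  assumes "0 < card (star 4 x)"
  shows "3 \<le> card (star 3 x)"
proof -
  obtain G where "G \<in> star 4 x" using assms by (metis card_gt_0_iff ex_in_conv)
  then show ?thesis using star_ge[of G x 2] by (simp add: star_def eval_nat_numeral)
qed

text \<open>Each of two faces of size 4 through \<open>x\<close> contains three faces of size 3
  through \<open>x\<close>. They share at most one of these, as their intersection has at most three
  elements, so at least 3 + 3 - 1 remain.\<close>

lemma star3_ge_5:
  assumes "2 \<le> card (star 4 x)"
  shows "5 \<le> card (star 3 x)"
proof -
  obtain G H where GH: "G \<in> star 4 x" "H \<in> star 4 x" "G \<noteq> H"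
    using assms card_le_Suc0_iff_eq[OF finite_star, of 4 x] by fastforce
  let ?sub = "\<lambda>G. {F. F \<subseteq> G \<and> x \<in> F \<and> card F = 3}"
  have G: "G \<in> S" "x \<in> G" "card G = 4" "finite G" and H: "H \<in> S" "x \<in> H" "card H = 4" "finite H"
    using GH finite_face by (auto simp: star_def)
  have cG: "card (?sub G) = 3" and cH: "card (?sub H) = 3"
    using card_subsets_containing[OF G(4,2), of 2] card_subsets_containing[OF H(4,2), of 2] G(3) H(3)
    by (simp_all add: eval_nat_numeral)
  have "card (G \<inter> H) \<noteq> 4" using GH(3) G H
    by (metis card_subset_eq inf_le1 inf_le2)
  moreover have "card (G \<inter> H) \<le> 4" using card_mono[OF G(4), of "G \<inter> H"] G(3) by simp
  ultimately have "card (G \<inter> H) - 1 \<le> 2" by linarith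
  then have "(card (G \<inter> H) - 1) choose 2 \<le> 2 choose 2" by (rule binomial_right_mono)
  then have "card (?sub (G \<inter> H)) \<le> 1"
    using card_subsets_containing[of "G \<inter> H" x 2] G H by (simp add: eval_nat_numeral)
  moreover have "?sub G \<inter> ?sub H = ?sub (G \<inter> H)" by auto
  moreover have "finite (?sub G)" "finite (?sub H)"
    using cG cH by (auto intro: card_ge_0_finite)
  ultimately have "5 \<le> card (?sub G \<union> ?sub H)"
    using card_Un_Int[of "?sub G" "?sub H"] cG cH by simp
  also have "\<dots> \<le> card (star 3 x)"
    using subfaces_star[OF G(1,2)] subfaces_star[OF H(1,2)] by (intro card_mono) auto
  finally show ?thesis .
qed

text \<open>A face of size 5 or more at \<open>x\<close> contributes at least the binomial
  coefficients 4, 6, 4. Otherwise all faces at \<open>x\<close> have size at most 4, and the degree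
  12 without the singleton leaves 11.\<close>

lemma big_face_or_degree:
  assumes "x \<in> vertices S"
  shows "4 \<le> card (nb x) \<and> 6 \<le> card (star 3 x) \<and> 4 \<le> card (star 4 x) \<or>
    11 \<le> card (nb x) + card (star 3 x) + card (star 4 x)"
proof (cases "\<exists>G\<in>S. x \<in> G \<and> 5 \<le> card G")
  case True
  then obtain G where G: "G \<in> S" "x \<in> G" "5 \<le> card G" by blast
  have m: "4 choose k \<le> card (star (Suc k) x)" for k
    using star_ge[OF G(1,2), of k] binomial_right_mono[of 4 "card G - 1" k] G(3) by linarith
  show ?thesis using m[of 1] m[of 2] m[of 3] card_star2[of x] by (simp add: eval_nat_numeral)
next
  case False
  have "{x} \<in> S" using assms face_subset by (auto simp: vertices_def)
  then have s1: "star 1 x = {{x}}" by (auto simp: star_def card_1_singleton_iff)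
  have "{F \<in> S. x \<in> F} \<subseteq> star 1 x \<union> star 2 x \<union> star 3 x \<union> star 4 x"
  proof
    fix F assume F: "F \<in> {F \<in> S. x \<in> F}"
    then have "card F < 5" "0 < card F" using False finite_face by (force, auto simp: card_gt_0_iff)
    then have "card F = 1 \<or> card F = 2 \<or> card F = 3 \<or> card F = 4" by linarith
    then show "F \<in> star 1 x \<union> star 2 x \<union> star 3 x \<union> star 4 x" using F by (auto simp: star_def)
  qed
  then have "vertex_degree S x \<le> card (star 1 x \<union> star 2 x \<union> star 3 x \<union> star 4 x)"
    unfolding vertex_degree_def by (intro card_mono) auto
  also have "\<dots> \<le> card (star 1 x) + card (star 2 x) + card (star 3 x) + card (star 4 x)"
    by (intro order_trans[OF card_Un_le] add_mono) auto
  finally show ?thesis using degree_ge[OF assms] s1 card_star2[of x] by simp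
qed

subsection \<open>The two deficient links\<close>

text \<open>The equivalence fixes the whole star of \<open>x\<close>. Its link consists of two
  filled triangles sharing the edge \<open>ab\<close>, with ends \<open>c\<close> and
  \<open>d\<close>; the weight is 60 + 120 + 100 + 30 = 310.\<close>

definition typeA :: "'a \<Rightarrow> 'a \<Rightarrow> 'a \<Rightarrow> 'a \<Rightarrow> 'a \<Rightarrow> bool" where
  "typeA x a b c d \<longleftrightarrow> distinct [x, a, b, c, d] \<and>
     (\<forall>F. x \<in> F \<longrightarrow> (F \<in> S \<longleftrightarrow> F \<subseteq> {x, a, b, c} \<or> F \<subseteq> {x, a, b, d}))"

text \<open>The link is a complete graph on four vertices in which only the base \<open>abc\<close>
  is filled, \<open>d\<close> being the apex; the weight is 60 + 120 + 120 + 15 = 315.\<close>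

definition typeB :: "'a \<Rightarrow> 'a \<Rightarrow> 'a \<Rightarrow> 'a \<Rightarrow> 'a \<Rightarrow> bool" where
  "typeB x a b c d \<longleftrightarrow> distinct [x, a, b, c, d] \<and>
     (\<forall>F. x \<in> F \<longrightarrow> (F \<in> S \<longleftrightarrow>
        F \<subseteq> {x, a, b, c} \<or> F \<subseteq> {x, a, d} \<or> F \<subseteq> {x, b, d} \<or> F \<subseteq> {x, c, d}))"

definition isA :: "'a \<Rightarrow> bool" where "isA x \<longleftrightarrow> (\<exists>a b c d. typeA x a b c d)"
definition isB :: "'a \<Rightarrow> bool" where "isB x \<longleftrightarrow> (\<exists>a b c d. typeB x a b c d)"

lemma typeA_numbers:
  assumes "typeA x a b c d"
  shows "nb x = {a, b, c, d}" "card (nb x) = 4" "card (star 3 x) = 5" "card (star 4 x) = 2"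
    "codeg 4 x a = 2" "codeg 4 x b = 2" "codeg 4 x c = 1" "codeg 4 x d = 1"
    "codeg 3 x a = 3" "codeg 3 x b = 3" "codeg 3 x c = 2" "codeg 3 x d = 2"
proof -
  have dist: "x \<noteq> a" "x \<noteq> b" "x \<noteq> c" "x \<noteq> d" "a \<noteq> b" "a \<noteq> c" "a \<noteq> d" "b \<noteq> c" "b \<noteq> d" "c \<noteq> d"
    using assms by (auto simp: typeA_def)
  note dist = dist dist[symmetric]
  have mem: "F \<in> S \<and> x \<in> F \<longleftrightarrow> x \<in> F \<and> (F \<subseteq> {x, a, b, c} \<or> F \<subseteq> {x, a, b, d})" for F
    using assms by (auto simp: typeA_def)
  have star: "{F \<in> S. x \<in> F} = insert x ` (Pow {a, b, c} \<union> insert d ` Pow {a, b})"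
  proof (intro equalityI subsetI)
    fix F assume F: "F \<in> {F \<in> S. x \<in> F}"
    then have sub: "F \<subseteq> {x, a, b, c} \<or> F \<subseteq> {x, a, b, d}" using mem[of F] by simp
    show "F \<in> insert x ` (Pow {a, b, c} \<union> insert d ` Pow {a, b})"
    proof (cases "d \<in> F")
      case True
      then have "F - {x, d} \<in> Pow {a, b}" using sub dist by auto
      then show ?thesis
        by (intro image_eqI[of F _ "insert d (F - {x, d})"] UnI2 imageI) (use F True in auto)
    next
      case False
      then have "F - {x} \<in> Pow {a, b, c}" using sub by auto
      then show ?thesis
        by (intro image_eqI[of F _ "F - {x}"] UnI1) (use F in auto)
    qed
  next
    fix F assume "F \<in> insert x ` (Pow {a, b, c} \<union> insert d ` Pow {a, b})"
    then show "F \<in> {F \<in> S. x \<in> F}" using mem[of F] by auto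
  qed
  have "y \<in> nb x \<longleftrightarrow> y \<in> {a, b, c, d}" for y
    unfolding nb_def using mem[of "{x, y}"] dist by auto
  then show "nb x = {a, b, c, d}" by blast
  then show "card (nb x) = 4" using dist by simp
  \<comment> \<open>The order is the one in which \<open>Pow_insert\<close> unfolds the description
    \<open>star\<close>, so that both sides become the same term.\<close>
  let ?faces = "[{x}, {x, c}, {x, b}, {x, b, c}, {x, a}, {x, a, c}, {x, a, b}, {x, a, b, c},
    {x, d}, {x, d, b}, {x, d, a}, {x, d, a, b}]"
  have "{F \<in> S. x \<in> F} = set ?faces"
    unfolding star Pow_insert Pow_empty image_Un image_insert image_empty Un_insert_left Un_empty_left
      list.set ..
  moreover have "distinct ?faces"
    by (simp add: dist set_eq_subset)
  ultimately have count: "card {F \<in> S. x \<in> F \<and> P F} = length (filter P ?faces)" for P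
    by (rule card_Collect_filter)
  show "card (star 3 x) = 5" "card (star 4 x) = 2"
    unfolding star_def count by (simp_all add: dist)
  show "codeg 4 x a = 2" "codeg 4 x b = 2" "codeg 4 x c = 1" "codeg 4 x d = 1"
    "codeg 3 x a = 3" "codeg 3 x b = 3" "codeg 3 x c = 2" "codeg 3 x d = 2"
    unfolding codeg_def count by (simp_all add: dist)
qed

lemma typeB_numbers:
  assumes "typeB x a b c d"
  shows "nb x = {a, b, c, d}" "card (nb x) = 4" "card (star 3 x) = 6" "card (star 4 x) = 1"
    "codeg 4 x a = 1" "codeg 4 x b = 1" "codeg 4 x c = 1" "codeg 4 x d = 0"
    "codeg 3 x a = 3" "codeg 3 x b = 3" "codeg 3 x c = 3" "codeg 3 x d = 3"
proof -
  have dist: "x \<noteq> a" "x \<noteq> b" "x \<noteq> c" "x \<noteq> d" "a \<noteq> b" "a \<noteq> c" "a \<noteq> d" "b \<noteq> c" "b \<noteq> d" "c \<noteq> d"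
    using assms by (auto simp: typeB_def)
  note dist = dist dist[symmetric]
  have mem: "F \<in> S \<and> x \<in> F \<longleftrightarrow> x \<in> F \<and> (F \<subseteq> {x, a, b, c} \<or> F \<subseteq> {x, a, d} \<or> F \<subseteq> {x, b, d} \<or> F \<subseteq> {x, c, d})" for F
    using assms by (auto simp: typeB_def)
  have star: "{F \<in> S. x \<in> F} = insert x ` (Pow {a, b, c} \<union> insert d ` {{}, {a}, {b}, {c}})"
  proof (intro equalityI subsetI)
    fix F assume F: "F \<in> {F \<in> S. x \<in> F}"
    then have sub: "F \<subseteq> {x, a, b, c} \<or> F \<subseteq> {x, a, d} \<or> F \<subseteq> {x, b, d} \<or> F \<subseteq> {x, c, d}" using mem[of F] by simp
    show "F \<in> insert x ` (Pow {a, b, c} \<union> insert d ` {{}, {a}, {b}, {c}})"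
    proof (cases "d \<in> F")
      case True
      then have "\<not> F \<subseteq> {x, a, b, c}" using dist by auto
      then have "F \<subseteq> {x, a, d} \<or> F \<subseteq> {x, b, d} \<or> F \<subseteq> {x, c, d}" using sub by simp
      then have "F - {x, d} \<subseteq> {a} \<or> F - {x, d} \<subseteq> {b} \<or> F - {x, d} \<subseteq> {c}"
        by (elim disjE) (intro disjI1 disjI2; fastforce)+
      then have "F - {x, d} \<in> {{}, {a}, {b}, {c}}" by (simp add: subset_singleton_iff) blast
      then show ?thesis
        by (intro image_eqI[of F _ "insert d (F - {x, d})"] UnI2 imageI) (use F True in auto)
    next
      case False
      then have "F - {x} \<in> Pow {a, b, c}" using sub by auto
      then show ?thesis
        by (intro image_eqI[of F _ "F - {x}"] UnI1) (use F in auto)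
    qed
  next
    fix F assume "F \<in> insert x ` (Pow {a, b, c} \<union> insert d ` {{}, {a}, {b}, {c}})"
    then show "F \<in> {F \<in> S. x \<in> F}" using mem[of F] by auto
  qed
  have "y \<in> nb x \<longleftrightarrow> y \<in> {a, b, c, d}" for y
    unfolding nb_def using mem[of "{x, y}"] dist by auto
  then show "nb x = {a, b, c, d}" by blast
  then show "card (nb x) = 4" using dist by simp
  let ?faces = "[{x}, {x, c}, {x, b}, {x, b, c}, {x, a}, {x, a, c}, {x, a, b}, {x, a, b, c},
    {x, d}, {x, d, a}, {x, d, b}, {x, d, c}]"
  have "{F \<in> S. x \<in> F} = set ?faces"
    unfolding star Pow_insert Pow_empty image_Un image_insert image_empty Un_insert_left Un_empty_left
      list.set ..
  moreover have "distinct ?faces"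
    by (simp add: dist set_eq_subset)
  ultimately have count: "card {F \<in> S. x \<in> F \<and> P F} = length (filter P ?faces)" for P
    by (rule card_Collect_filter)
  show "card (star 3 x) = 6" "card (star 4 x) = 1"
    unfolding star_def count by (simp_all add: dist)
  show "codeg 4 x a = 1" "codeg 4 x b = 1" "codeg 4 x c = 1" "codeg 4 x d = 0"
    "codeg 3 x a = 3" "codeg 3 x b = 3" "codeg 3 x c = 3" "codeg 3 x d = 3"
    unfolding codeg_def count by (simp_all add: dist)
qed

lemma typeA_sym: "typeA x a b c d \<Longrightarrow> typeA x b a c d" "typeA x a b c d \<Longrightarrow> typeA x a b d c"
  unfolding typeA_def by (auto simp: insert_commute)

lemma typeB_sym: "typeB x a b c d \<Longrightarrow> typeB x b a c d" "typeB x a b c d \<Longrightarrow> typeB x c b a d"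
  unfolding typeB_def by (auto simp: insert_commute)

text \<open>By the two symmetries, a neighbour can be moved to the first place of the shared edge or
  to the first end.\<close>

lemma typeA_cases:
  assumes "isA x" "u \<in> nb x"
  obtains b c d where "typeA x u b c d" | a b d where "typeA x a b u d"
proof -
  obtain a b c d where t: "typeA x a b c d" using assms(1) by (auto simp: isA_def)
  then have "u = a \<or> u = b \<or> u = c \<or> u = d" using assms(2) typeA_numbers(1) by auto
  then show thesis
    using t typeA_sym(1)[OF t] typeA_sym(2)[OF t] that by (elim disjE) simp_all
qed

lemma typeB_cases:
  assumes "isB x" "u \<in> nb x"
  obtains b c d where "typeB x u b c d" | a b c where "typeB x a b c u"
proof -
  obtain a b c d where t: "typeB x a b c d" using assms(1) by (auto simp: isB_def)
  then have "u = a \<or> u = b \<or> u = c \<or> u = d" using assms(2) typeB_numbers(1) by auto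
  then show thesis
    using t typeB_sym(1)[OF t] typeB_sym(2)[OF t] that by (elim disjE) simp_all
qed

text \<open>Four neighbours span six possible link edges. If five are present, exactly one pair
  \<open>cd\<close> is missing, so every link face lies in \<open>abc\<close> or \<open>abd\<close>.
  Two faces of size 4 at \<open>x\<close> then force both triangles to be filled.\<close>

lemma isA_iff_numbers:
  "isA x \<longleftrightarrow> card (nb x) = 4 \<and> card (star 3 x) = 5 \<and> 2 \<le> card (star 4 x)"
proof
  assume "isA x"
  then show "card (nb x) = 4 \<and> card (star 3 x) = 5 \<and> 2 \<le> card (star 4 x)"
    unfolding isA_def using typeA_numbers(2-4) by fastforce
next
  assume num: "card (nb x) = 4 \<and> card (star 3 x) = 5 \<and> 2 \<le> card (star 4 x)"
  have "card {F. F \<subseteq> insert x (nb x) \<and> x \<in> F \<and> card F = 3} = 6"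
    using card_subsets_containing[of "insert x (nb x)" x 2] num by (simp add: eval_nat_numeral)
  then have "\<not> {F. F \<subseteq> insert x (nb x) \<and> x \<in> F \<and> card F = 3} \<subseteq> star 3 x"
    using card_mono[OF finite_star[of 3 x], of "{F. F \<subseteq> insert x (nb x) \<and> x \<in> F \<and> card F = 3}"] num
    by linarith
  then obtain F where F: "F \<subseteq> insert x (nb x)" "x \<in> F" "card F = 3" "F \<notin> S"
    by (auto simp: star_def)
  have "finite F" using F(3) by (auto intro: card_ge_0_finite)
  then have "card (F - {x}) = 2" using F by simp
  then obtain c d where cd: "F - {x} = {c, d}" "c \<noteq> d" by (auto simp: card_2_iff)
  then have Fx: "F = {x, c, d}" and cdn: "{c, d} \<subseteq> nb x" using F by auto
  then have "card (nb x - {c, d}) = 2" using num cd(2) by (simp add: card_Diff_subset)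
  then obtain a b where ab: "nb x - {c, d} = {a, b}" "a \<noteq> b" by (auto simp: card_2_iff)
  then have nbx: "nb x = {a, b, c, d}" using cdn by auto
  have dist: "distinct [x, a, b, c, d]" using ab cd cdn self_notin_nb[of x] nbx by auto
  have sub: "G \<subseteq> {x, a, b, c} \<or> G \<subseteq> {x, a, b, d}" if G: "G \<in> S" "x \<in> G" for G
  proof -
    have "G \<subseteq> {x, a, b, c, d}" using face_subset_nb[OF G] nbx by auto
    then have "c \<notin> G \<Longrightarrow> G \<subseteq> {x, a, b, d}" "d \<notin> G \<Longrightarrow> G \<subseteq> {x, a, b, c}" by auto
    moreover have "c \<notin> G \<or> d \<notin> G" using face_subset[OF G(1), of F] G(2) F(4) Fx by auto
    ultimately show ?thesis by metis
  qed
  have "star 4 x \<subseteq> {{x, a, b, c}, {x, a, b, d}}"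
  proof
    fix G assume "G \<in> star 4 x"
    then have G: "G \<in> S" "x \<in> G" "card G = 4" by (auto simp: star_def)
    have "card {x, a, b, c} = 4" "card {x, a, b, d} = 4" using dist by auto
    then have "G = {x, a, b, c} \<or> G = {x, a, b, d}"
      using sub[OF G(1,2)] G(3) card_subset_eq[of "{x, a, b, c}" G] card_subset_eq[of "{x, a, b, d}" G]
      by (metis finite.emptyI finite.insertI)
    then show "G \<in> {{x, a, b, c}, {x, a, b, d}}" by simp
  qed
  moreover have "card {{x, a, b, c}, {x, a, b, d}} \<le> card (star 4 x)"
    using num card_2_iff[of "{{x, a, b, c}, {x, a, b, d}}"] by (simp add: card_insert_if)
  ultimately have "star 4 x = {{x, a, b, c}, {x, a, b, d}}" by (intro card_seteq) auto
  then have facets: "{x, a, b, c} \<in> S" "{x, a, b, d} \<in> S" by (auto simp: star_def)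
  have "F \<in> S" if "F \<subseteq> {x, a, b, c} \<or> F \<subseteq> {x, a, b, d}" for F
    using that facets[THEN face_subset, of F] by metis
  then have "typeA x a b c d" unfolding typeA_def using dist sub by metis
  then show "isA x" by (auto simp: isA_def)
qed

text \<open>All six link edges are present. The only face of size 4 at \<open>x\<close> gives the
  base \<open>abc\<close>; a link face through the fourth neighbour \<open>d\<close> cannot contain
  two base vertices, since that would give a second face of size 4.\<close>

lemma isB_iff_numbers:
  "isB x \<longleftrightarrow> card (nb x) = 4 \<and> card (star 3 x) = 6 \<and> card (star 4 x) = 1"
proof
  assume "isB x"
  then show "card (nb x) = 4 \<and> card (star 3 x) = 6 \<and> card (star 4 x) = 1"
    unfolding isB_def using typeB_numbers(2-4) by fastforce
next
  assume num: "card (nb x) = 4 \<and> card (star 3 x) = 6 \<and> card (star 4 x) = 1"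
  have "card {F. F \<subseteq> insert x (nb x) \<and> x \<in> F \<and> card F = 3} = 6"
    using card_subsets_containing[of "insert x (nb x)" x 2] num by (simp add: eval_nat_numeral)
  then have star3: "star 3 x = {F. F \<subseteq> insert x (nb x) \<and> x \<in> F \<and> card F = 3}"
    using num by (intro card_subset_eq star_subset) auto
  obtain G where star4: "star 4 x = {G}" using num by (auto simp: card_1_singleton_iff)
  then have G: "G \<in> S" "x \<in> G" "card G = 4" by (auto simp: star_def)
  have Gn: "G - {x} \<subseteq> nb x" using face_subset_nb[OF G(1,2)] by auto
  have card3: "card (G - {x}) = 3" using G finite_face by simp
  then obtain a b c where abc: "G - {x} = {a, b, c}" "a \<noteq> b" "b \<noteq> c" "a \<noteq> c"
    by (auto simp: card_3_iff)
  have "card (nb x - (G - {x})) = 1"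
    using card_Diff_subset[OF finite_subset[OF Gn] Gn] num card3 by simp
  then obtain d where d: "nb x - (G - {x}) = {d}" by (auto simp: card_1_singleton_iff)
  then have nbx: "nb x = {a, b, c, d}" using Gn abc by auto
  have Gx: "G = {x, a, b, c}" using abc G by auto
  have dist: "distinct [x, a, b, c, d]" using abc d self_notin_nb[of x] nbx by auto
  have three: "{x, y, z} \<in> S" if "y \<in> nb x" "z \<in> nb x" "y \<noteq> z" for y z
  proof -
    have "x \<noteq> y" "x \<noteq> z" using that self_notin_nb by auto
    then have "card {x, y, z} = 3" using that by simp
    then have "{x, y, z} \<in> star 3 x" using that star3 by auto
    then show ?thesis by (simp add: star_def)
  qed
  have no4: "\<not> (F \<in> S \<and> {x, y, z, d} \<subseteq> F)" if "y \<in> {a, b, c}" "z \<in> {a, b, c}" "y \<noteq> z" for F y z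
  proof
    assume "F \<in> S \<and> {x, y, z, d} \<subseteq> F"
    moreover have "card {x, y, z, d} = 4" using that dist by auto
    ultimately have "{x, y, z, d} \<in> star 4 x" using face_subset[of F "{x, y, z, d}"] by (simp add: star_def)
    then have "d \<in> G" using star4 by auto
    then show False using dist Gx by auto
  qed
  have sub: "F \<subseteq> {x, a, b, c} \<or> F \<subseteq> {x, a, d} \<or> F \<subseteq> {x, b, d} \<or> F \<subseteq> {x, c, d}"
    if F: "F \<in> S" "x \<in> F" for F
  proof -
    have F': "F \<subseteq> {x, a, b, c, d}" using face_subset_nb[OF F] nbx by auto
    have "b \<notin> F \<Longrightarrow> c \<notin> F \<Longrightarrow> F \<subseteq> {x, a, d}" "a \<notin> F \<Longrightarrow> c \<notin> F \<Longrightarrow> F \<subseteq> {x, b, d}"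
      "a \<notin> F \<Longrightarrow> b \<notin> F \<Longrightarrow> F \<subseteq> {x, c, d}" "d \<notin> F \<Longrightarrow> F \<subseteq> {x, a, b, c}"
      using F' by auto
    moreover have "\<not> {x, a, b, d} \<subseteq> F" "\<not> {x, a, c, d} \<subseteq> F" "\<not> {x, b, c, d} \<subseteq> F"
      using no4[of a b F] no4[of a c F] no4[of b c F] F(1) dist by auto
    then have "d \<notin> F \<or> a \<notin> F \<and> b \<notin> F \<or> a \<notin> F \<and> c \<notin> F \<or> b \<notin> F \<and> c \<notin> F"
      using F(2) by simp metis
    ultimately show ?thesis by metis
  qed
  have facets: "{x, a, b, c} \<in> S" "{x, a, d} \<in> S" "{x, b, d} \<in> S" "{x, c, d} \<in> S"
    using three nbx dist G(1) Gx by auto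
  have "F \<in> S" if "F \<subseteq> {x, a, b, c} \<or> F \<subseteq> {x, a, d} \<or> F \<subseteq> {x, b, d} \<or> F \<subseteq> {x, c, d}" for F
    using that facets[THEN face_subset, of F] by metis
  then have "typeB x a b c d" unfolding typeB_def using dist sub by metis
  then show "isB x" by (auto simp: isB_def)
qed

subsection \<open>Discharging\<close>

text \<open>
  For \<open>x\<close> of type A, \<open>codeg 4 x u\<close> is \<open>2\<close> if \<open>u\<close> is \<open>a\<close> or \<open>b\<close>, and \<open>1\<close> if \<open>u\<close> is \<open>c\<close> or \<open>d\<close>; for
  \<open>x\<close> of type B it is \<open>0\<close> exactly if \<open>u\<close> is \<open>d\<close>. The value of \<open>pay u x\<close> is meaningful only for \<open>u \<in> nb x\<close>.
\<close>
definition pay :: "'a \<Rightarrow> 'a \<Rightarrow> nat" where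
  "pay u x =
    (if isA x then
       if codeg 4 x u = 2 then if isA u then 0 else 4
       else 2 * (\<Sum>a\<in>nb x. if codeg 4 x a = 2 \<and> isA a then 1 else 0)
     else if isB x then
       if codeg 4 x u = 0 then if isB u then 0 else 3
       else if \<exists>d\<in>nb x. codeg 4 x d = 0 \<and> isB d then 1 else 0
     else 0)"

lemma isB_not_isA: "isB x \<Longrightarrow> \<not> isA x"
  by (simp add: isA_iff_numbers isB_iff_numbers)

lemma pay_values:
  "typeA x u b c d \<Longrightarrow> pay u x = (if isA u then 0 else 4)"
  "typeA x a b u d \<Longrightarrow> pay u x = (if isA a then 2 else 0) + (if isA b then 2 else 0)"
  "typeB x u b c d \<Longrightarrow> pay u x = (if isB d then 1 else 0)"
  "typeB x a b c u \<Longrightarrow> pay u x = (if isB u then 0 else 3)"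
proof -
  show "pay u x = (if isA u then 0 else 4)" if t: "typeA x u b c d"
    using typeA_numbers[OF t] t by (auto simp: pay_def isA_def)
  show "pay u x = (if isA a then 2 else 0) + (if isA b then 2 else 0)" if t: "typeA x a b u d"
  proof -
    have "isA x" "distinct [a, b, u, d]" using t by (auto simp: isA_def typeA_def)
    then show ?thesis using typeA_numbers[OF t] by (simp add: pay_def)
  qed
  show "pay u x = (if isB d then 1 else 0)" if t: "typeB x u b c d"
  proof -
    have "isB x" using t by (auto simp: isB_def)
    then show ?thesis using typeB_numbers[OF t] isB_not_isA by (simp add: pay_def)
  qed
  show "pay u x = (if isB u then 0 else 3)" if t: "typeB x a b c u"
  proof -
    have "isB x" using t by (auto simp: isB_def)
    then show ?thesis using typeB_numbers[OF t] isB_not_isA by (simp add: pay_def)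
  qed
qed

text \<open>Each of \<open>a\<close>, \<open>b\<close> accounts for 4: it pays this itself, or,
  being of type A, makes \<open>c\<close> and \<open>d\<close> pay 2 each.\<close>

lemma received_A:
  assumes "isA x"
  shows "8 \<le> (\<Sum>u\<in>nb x. pay u x)"
proof -
  obtain a b c d where t: "typeA x a b c d" using assms by (auto simp: isA_def)
  have "distinct [a, b, c, d]" using t by (simp add: typeA_def)
  then show ?thesis
    using pay_values(1)[OF t] pay_values(1)[OF typeA_sym(1)[OF t]]
      pay_values(2)[OF t] pay_values(2)[OF typeA_sym(2)[OF t]]
    by (simp add: typeA_numbers(1)[OF t])
qed

text \<open>Either the apex pays 3, or it is of type B and the three base vertices pay 1
  each.\<close>

lemma received_B:
  assumes "isB x"
  shows "3 \<le> (\<Sum>u\<in>nb x. pay u x)"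
proof -
  obtain a b c d where t: "typeB x a b c d" using assms by (auto simp: isB_def)
  have "distinct [a, b, c, d]" using t by (simp add: typeB_def)
  then show ?thesis
    using pay_values(3)[OF t] pay_values(3)[OF typeB_sym(1)[OF t]]
      pay_values(3)[OF typeB_sym(2)[OF t]] pay_values(4)[OF t]
    by (simp add: typeB_numbers(1)[OF t])
qed

text \<open>A payment is bounded by codegrees at the payer, so that a total load can be bounded by
  \<open>sum_codeg3\<close> and \<open>sum_codeg4\<close>. With \<open>codeg 4 u x = 0\<close>, only
  the apex of a type B link pays. The exception \<open>codeg 3 u x = 2\<close> in the last bound is
  the end of a type A link, which may pay 4 with \<open>codeg 4 u x = 1\<close>.\<close>

lemma pay_bounds:
  assumes "x \<in> nb u"
  shows "pay u x \<le> 4" "pay u x \<le> 2 * codeg 3 u x"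
    "codeg 4 u x = 0 \<Longrightarrow> pay u x \<le> codeg 3 u x"
    "codeg 4 u x = 0 \<Longrightarrow> 0 < pay u x \<Longrightarrow> codeg 3 u x = 3"
    "codeg 4 u x \<noteq> 0 \<Longrightarrow> codeg 3 u x \<noteq> 2 \<Longrightarrow> pay u x \<le> 2 * codeg 4 u x"
proof -
  have u: "u \<in> nb x" using assms nb_sym by blast
  have "pay u x \<le> 4 \<and> pay u x \<le> 2 * codeg 3 x u \<and> (codeg 4 x u = 0 \<longrightarrow> pay u x \<le> codeg 3 x u) \<and>
    (codeg 4 x u = 0 \<longrightarrow> 0 < pay u x \<longrightarrow> codeg 3 x u = 3) \<and>
    (codeg 4 x u \<noteq> 0 \<longrightarrow> codeg 3 x u \<noteq> 2 \<longrightarrow> pay u x \<le> 2 * codeg 4 x u)"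
  proof (cases "isA x")
    case True
    then show ?thesis using u
      by (cases rule: typeA_cases) (simp_all add: pay_values typeA_numbers)
  next
    case notA: False
    show ?thesis
    proof (cases "isB x")
      case True
      then show ?thesis using u
        by (cases rule: typeB_cases) (simp_all add: pay_values typeB_numbers)
    next
      case False
      then show ?thesis using notA by (simp add: pay_def)
    qed
  qed
  then show "pay u x \<le> 4" "pay u x \<le> 2 * codeg 3 u x"
    "codeg 4 u x = 0 \<Longrightarrow> pay u x \<le> codeg 3 u x"
    "codeg 4 u x = 0 \<Longrightarrow> 0 < pay u x \<Longrightarrow> codeg 3 u x = 3"
    "codeg 4 u x \<noteq> 0 \<Longrightarrow> codeg 3 u x \<noteq> 2 \<Longrightarrow> pay u x \<le> 2 * codeg 4 u x"
    by (simp_all add: codeg_commute)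
qed

section \<open>Deficient vertices pay nothing\<close>

lemma isA_codeg4: "isA u \<Longrightarrow> y \<in> nb u \<Longrightarrow> codeg 4 u y = 1 \<or> codeg 4 u y = 2"
  by (erule (1) typeA_cases) (auto dest: typeA_numbers(5,7))

text \<open>Each of the two faces of size 4 at \<open>u\<close> contains the whole shared edge and
  only one end, and the ends are the neighbours of codegree 1.\<close>

lemma isA_facet_codeg4:
  assumes "isA u" "G \<in> S" "card G = 4" "u \<in> G" "x \<in> G" "y \<in> G" "distinct [u, x, y]" "codeg 4 u x = 1"
  shows "codeg 4 u y = 2"
proof -
  obtain p q r s where t: "typeA u p q r s" using assms(1) by (auto simp: isA_def)
  note num = typeA_numbers[OF t]
  have "G \<subseteq> {u, p, q, r} \<or> G \<subseteq> {u, p, q, s}" using t assms(2,4) by (auto simp: typeA_def)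
  then have "x \<in> {p, q, r} \<and> y \<in> {p, q, r} \<or> x \<in> {p, q, s} \<and> y \<in> {p, q, s}"
    using assms(5-7) by auto
  then show ?thesis using num assms(7,8) by auto
qed

lemma isA_codeg4_not_all_2:
  assumes "isA u" "y \<in> nb u" "z \<in> nb u" "w \<in> nb u" "distinct [y, z, w]"
  shows "\<not> (2 \<le> codeg 4 u y \<and> 2 \<le> codeg 4 u z \<and> 2 \<le> codeg 4 u w)"
proof -
  obtain p q r s where t: "typeA u p q r s" using assms(1) by (auto simp: isA_def)
  note num = typeA_numbers[OF t]
  show ?thesis using num assms(2-5) by auto
qed

text \<open>If \<open>u\<close> were of type A as well, \<open>x\<close> would be an end of its
  link, hence \<open>codeg 4 u a = 2\<close>. Then \<open>x\<close>, \<open>b\<close> and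
  \<open>u\<close> would all have codegree at least 2 at \<open>a\<close>, whereas a type A link has
  just two such vertices.\<close>

lemma typeA_end_not_isA:
  assumes t: "typeA x a b u d" and "isA a"
  shows "\<not> isA u"
proof
  assume "isA u"
  have dist: "distinct [x, a, b, u, d]" using t by (simp add: typeA_def)
  have facets: "{x, a, b, u} \<in> S" "{x, a, b, d} \<in> S" using t by (auto simp: typeA_def)
  have "codeg 4 u a = 2"
    using isA_facet_codeg4[OF \<open>isA u\<close> facets(1), of x a] typeA_numbers(7)[OF t] dist
    by (auto simp: codeg_commute)
  moreover have "codeg 4 x a = 2" using typeA_numbers[OF t] by simp
  moreover have "2 \<le> codeg 4 a b"
  proof -
    have "{{x, a, b, u}, {x, a, b, d}} \<subseteq> {F \<in> S. a \<in> F \<and> b \<in> F \<and> card F = 4}"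
      using facets dist by simp
    then have "card {{x, a, b, u}, {x, a, b, d}} \<le> codeg 4 a b"
      unfolding codeg_def using finite_S by (intro card_mono) auto
    moreover have "{x, a, b, u} \<noteq> {x, a, b, d}" using dist by (auto simp: set_eq_subset)
    ultimately show ?thesis by simp
  qed
  moreover have "x \<in> nb a" "b \<in> nb a" "u \<in> nb a"
    using nbI[OF facets(1), of a] dist by auto
  ultimately show False
    using isA_codeg4_not_all_2[OF \<open>isA a\<close>, of x b u] dist by (simp add: codeg_commute)
qed

text \<open>The links of \<open>x\<close> and \<open>d\<close> have the same base
  \<open>abc\<close>, with \<open>d\<close> and \<open>x\<close> as apexes. So \<open>a\<close> lies
  in both faces \<open>xabc\<close> and \<open>dabc\<close> and in a face of size 3 with any two of
  \<open>x\<close>, \<open>b\<close>, \<open>c\<close>, \<open>d\<close>; this is too much for type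
  A and for type B.\<close>

lemma typeB_apex_B_base:
  assumes t: "typeB x a b c d" and "isB d"
  shows "6 \<le> card (star 3 a)" "2 \<le> card (star 4 a)"
proof -
  have dist: "distinct [x, a, b, c, d]" using t by (simp add: typeB_def)
  have faces: "{x, a, b, c} \<in> S" "{x, a, d} \<in> S" "{x, b, d} \<in> S" "{x, c, d} \<in> S"
    using t by (auto simp: typeB_def)
  have "x \<in> nb d" "a \<in> nb d" "b \<in> nb d" "c \<in> nb d"
    using nbI[OF faces(2), of d] nbI[OF faces(3), of d] nbI[OF faces(4), of d] dist by auto
  moreover have "codeg 4 d x = 0" using typeB_numbers[OF t] by (simp add: codeg_commute)
  \<comment> \<open>In a type B link only the apex has codegree 0, so \<open>x\<close> is the apex
    for \<open>d\<close>.\<close>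
  ultimately obtain p q r where t': "typeB d p q r x"
    using \<open>isB d\<close> by (elim typeB_cases) (auto dest: typeB_numbers(5))
  have "{a, b, c} \<subseteq> {p, q, r}"
    using typeB_numbers(1)[OF t'] \<open>a \<in> nb d\<close> \<open>b \<in> nb d\<close> \<open>c \<in> nb d\<close> dist by auto
  moreover have "card {a, b, c} = card {p, q, r}"
    using dist t' by (simp add: typeB_def)
  ultimately have eq: "{a, b, c} = {p, q, r}" by (intro card_subset_eq) auto
  have "{d, p, q, r} \<in> S" using t' by (auto simp: typeB_def)
  then have face_d: "{d, a, b, c} \<in> S" using eq by simp
  have "set [{x, a, b, c}, {d, a, b, c}] \<subseteq> star 4 a"
    using faces face_d dist by (auto simp: star_def)
  moreover have "distinct [{x, a, b, c}, {d, a, b, c}]"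
    using dist by (simp add: set_eq_subset)
  ultimately show "2 \<le> card (star 4 a)"
    using card_mono[OF finite_star, of "set [{x, a, b, c}, {d, a, b, c}]"] distinct_card
    by fastforce
  let ?L = "[{a, x, b}, {a, x, c}, {a, b, c}, {a, x, d}, {a, d, b}, {a, d, c}]"
  have "{a, x, b} \<in> S" "{a, x, c} \<in> S" "{a, b, c} \<in> S"
    by (rule face_subset[OF faces(1)]; simp)+
  moreover have "{a, x, d} \<in> S" "{a, d, b} \<in> S" "{a, d, c} \<in> S"
    by (rule face_subset[OF faces(2)], simp) (rule face_subset[OF face_d]; simp)+
  ultimately have "set ?L \<subseteq> star 3 a"
    using dist by (auto simp: star_def)
  moreover have "distinct ?L"
    using dist by (auto simp: set_eq_subset)
  ultimately show "6 \<le> card (star 3 a)"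
    using card_mono[OF finite_star, of "set ?L" 3 a] distinct_card[of ?L] by simp
qed

lemma pay_eq_0: "\<not> isA x \<Longrightarrow> \<not> isB x \<Longrightarrow> pay u x = 0"
  by (simp add: pay_def)

text \<open>On the shared edge of a type A link nothing is due by definition, and at an end
  \<open>typeA_end_not_isA\<close> leaves no debt. In a type B link \<open>u\<close> cannot be the
  apex, and as a base vertex it owes nothing by \<open>typeB_apex_B_base\<close>.\<close>

lemma isA_pays_0:
  assumes "isA u" "x \<in> nb u"
  shows "pay u x = 0"
proof -
  have u: "u \<in> nb x" using assms(2) nb_sym by blast
  consider "isA x" | "isB x" | "pay u x = 0" using pay_eq_0[of x u] by metis
  then show ?thesis
  proof cases
    case 1
    then show ?thesis using u
    proof (cases rule: typeA_cases)
      case (1 b c d)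
      then show ?thesis using assms(1) by (simp add: pay_values)
    next
      case (2 a b d)
      then have "\<not> isA a" "\<not> isA b"
        using typeA_end_not_isA[OF 2] typeA_end_not_isA[OF typeA_sym(1)[OF 2]] assms(1) by auto
      then show ?thesis using 2 by (simp add: pay_values)
    qed
  next
    case 2
    then show ?thesis using u
    proof (cases rule: typeB_cases)
      case (1 b c d)
      then have "\<not> isB d" using typeB_apex_B_base[OF 1] assms(1) by (auto simp: isA_iff_numbers)
      then show ?thesis using 1 by (simp add: pay_values)
    next
      case (2 a b c)
      then show ?thesis using isA_codeg4[OF assms] typeB_numbers(8)[OF 2] by (simp add: codeg_commute)
    qed
  qed
qed

text \<open>A vertex of type B lies in one face of size 4 and has \<open>codeg 3 u x = 3\<close> for
  each neighbour \<open>x\<close>. The first keeps it off the shared edge of a type A link, the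
  second from being an end.\<close>

lemma isB_pays_0:
  assumes "isB u" "x \<in> nb u"
  shows "pay u x = 0"
proof -
  have u: "u \<in> nb x" using assms(2) nb_sym by blast
  have star4: "card (star 4 u) = 1" using assms(1) by (simp add: isB_iff_numbers)
  have codeg3: "codeg 3 u x = 3"
    using assms by (cases rule: typeB_cases) (simp_all add: typeB_numbers)
  consider "isA x" | "isB x" | "pay u x = 0" using pay_eq_0[of x u] by metis
  then show ?thesis
  proof cases
    case 1
    then show ?thesis using u
    proof (cases rule: typeA_cases)
      case (1 b c d)
      then show ?thesis
        using typeA_numbers(5)[OF 1] codeg_le_star[of 4 u x] star4 by (simp add: codeg_commute)
    next
      case (2 a b d)
      then show ?thesis using typeA_numbers(11)[OF 2] codeg3 by (simp add: codeg_commute)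
    qed
  next
    case 2
    then show ?thesis using u
    proof (cases rule: typeB_cases)
      case (1 b c d)
      then have "\<not> isB d" using typeB_apex_B_base[OF 1] star4 by auto
      then show ?thesis using 1 by (simp add: pay_values)
    next
      case (2 a b c)
      then show ?thesis using assms(1) by (simp add: pay_values)
    qed
  qed
qed

section \<open>Loads of the vertices that are not deficient\<close>

lemma unique_facet_isA:
  assumes "star 4 u = {G}" "isA z" "u \<in> nb z" "F \<in> S" "z \<in> F" "u \<in> F"
  shows "F \<subseteq> G"
  using assms(2,3)
proof (cases rule: typeA_cases)
  \<comment> \<open>A vertex of the shared edge lies in two faces of size 4, so \<open>u\<close>
    must be an end, and its only facet at \<open>z\<close> is \<open>G\<close>.\<close>
  case (1 b c d)
  then show ?thesis
    using typeA_numbers(5)[OF 1] codeg_le_star[of 4 u z] assms(1) by (simp add: codeg_commute)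
next
  case (2 a b d)
  then have dist: "distinct [z, a, b, u, d]" and "{z, a, b, u} \<in> S"
    by (auto simp: typeA_def)
  then have "{z, a, b, u} \<in> star 4 u" by (simp add: star_def)
  then have G: "G = {z, a, b, u}" using assms(1) by simp
  have "F \<subseteq> {z, a, b, u} \<or> F \<subseteq> {z, a, b, d}" using 2 assms(4,5) by (auto simp: typeA_def)
  then show ?thesis using assms(6) dist G by auto
qed

text \<open>The slack is only 150 + 100 + 15 - 258 = 7, while the bounds in \<open>load_le\<close>
  give 20.\<close>

lemma load_5_5_1:
  assumes nb5: "card (nb u) = 5" and star3: "card (star 3 u) = 5" and star4: "card (star 4 u) = 1"
  shows "(\<Sum>x\<in>nb u. pay u x) \<le> 6"
proof -
  obtain G where starG: "star 4 u = {G}" using star4 by (auto simp: card_1_singleton_iff)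
  then have G: "G \<in> S" "u \<in> G" "card G = 4" by (auto simp: star_def)
  then have Gn: "G - {u} \<subseteq> nb u" using face_subset_nb[OF G(1,2)] by auto
  have cardG: "card (G - {u}) = 3" using G finite_face by simp
  have inG: "{F. F \<subseteq> G \<and> u \<in> F \<and> card F = 3} \<subseteq> star 3 u" by (rule subfaces_star[OF G(1,2)])
  have card_inG: "card {F. F \<subseteq> G \<and> u \<in> F \<and> card F = 3} = 3"
    using card_subsets_containing[OF finite_face[OF G(1)] G(2), of 2] G(3) by (simp add: eval_nat_numeral)
  have fin_inG: "finite {F. F \<subseteq> G \<and> u \<in> F \<and> card F = 3}"
    using inG finite_star finite_subset by blast
  \<comment> \<open>A positive payment outside \<open>G\<close> needs three faces of size 3 through
    \<open>x\<close>; with the three inside \<open>G\<close> there would be six.\<close>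
  have outside: "pay u x = 0" if x: "x \<in> nb u - (G - {u})" for x
  proof (rule ccontr)
    assume "pay u x \<noteq> 0"
    have "x \<notin> G" using x self_notin_nb[of u] by auto
    then have "codeg 4 u x = 0"
      using starG unfolding codeg_def star_def by (subst card_0_eq) (use finite_S in auto)
    then have c3: "codeg 3 u x = 3" using pay_bounds(4) x \<open>pay u x \<noteq> 0\<close> by auto
    let ?X = "{F \<in> S. u \<in> F \<and> x \<in> F \<and> card F = 3}"
    have "?X \<subseteq> star 3 u" by (auto simp: star_def)
    then have "card (?X \<union> {F. F \<subseteq> G \<and> u \<in> F \<and> card F = 3}) \<le> card (star 3 u)"
      using inG by (intro card_mono Un_least finite_star)
    moreover have "?X \<inter> {F. F \<subseteq> G \<and> u \<in> F \<and> card F = 3} = {}" using \<open>x \<notin> G\<close> by auto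
    ultimately show False
      using c3 card_inG fin_inG finite_S star3 by (simp add: card_Un_disjoint codeg_def)
  qed
  \<comment> \<open>A larger payment makes \<open>u\<close> an end of a type A link whose shared
    edge has both vertices of type A, so that all of \<open>G - {u}\<close> is of type A and
    \<open>unique_facet_isA\<close> applies to each of its vertices.\<close>
  have inside: "pay u x \<le> 2" if x: "x \<in> G - {u}" for x
  proof (rule ccontr)
    assume contr: "\<not> pay u x \<le> 2"
    have xn: "x \<in> nb u" "u \<in> nb x" using x Gn nb_sym by auto
    have c4: "0 < codeg 4 u x" "codeg 4 u x \<le> 1"
      using codeg_pos[OF G(1,2) _ G(3), of x] x codeg_le_star[of 4 u x] star4 by auto
    have "isA x"
    proof (rule ccontr)
      assume "\<not> isA x"
      then have "isB x" using contr by (auto simp: pay_def split: if_splits)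
      then show False using xn(2)
      proof (cases rule: typeB_cases)
        case (1 b c d)
        then show ?thesis using contr by (simp add: pay_values split: if_splits)
      next
        case (2 a b c)
        then show ?thesis using typeB_numbers(8)[OF 2] c4 by (simp add: codeg_commute)
      qed
    qed
    then show False using xn(2)
    proof (cases rule: typeA_cases)
      case (1 b c d)
      then show ?thesis using typeA_numbers(5)[OF 1] c4 by (simp add: codeg_commute)
    next
      case (2 a b d)
      then have AA: "isA a" "isA b" using contr by (auto simp: pay_values split: if_splits)
      have dist: "distinct [x, a, b, u, d]" and "{x, a, b, u} \<in> S"
        using 2 by (auto simp: typeA_def)
      then have "{x, a, b, u} \<in> star 4 u" by (simp add: star_def)
      then have Geq: "G = {x, a, b, u}" using starG by simp
      then have "z \<in> G - {u} \<Longrightarrow> isA z" for z using AA \<open>isA x\<close> by auto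
      then have sub: "F \<subseteq> G" if "F \<in> S" "u \<in> F" "z \<in> F" "z \<in> G - {u}" for F z
        using unique_facet_isA[OF starG, of z F] that Gn nb_sym by blast
      \<comment> \<open>A face of size 3 avoiding \<open>G - {u}\<close> can only be
        \<open>u\<close> with its two neighbours outside \<open>G\<close>. This leaves at most four
        faces of size 3 instead of five.\<close>
      have "star 3 u \<subseteq> insert (insert u (nb u - G)) {F. F \<subseteq> G \<and> u \<in> F \<and> card F = 3}"
      proof
        fix F assume "F \<in> star 3 u"
        then have F: "F \<in> S" "u \<in> F" "card F = 3" by (auto simp: star_def)
        show "F \<in> insert (insert u (nb u - G)) {F. F \<subseteq> G \<and> u \<in> F \<and> card F = 3}"
        proof (cases "F \<inter> (G - {u}) = {}")
          case True
          have nbG: "nb u - G = nb u - (G - {u})" using self_notin_nb[of u] by auto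
          have "card (nb u - G) = 2"
            unfolding nbG using card_Diff_subset[OF finite_subset[OF Gn] Gn] cardG nb5 by simp
          then have "card (insert u (nb u - G)) = 3" using G(2) by simp
          moreover have "F \<subseteq> insert u (nb u - G)" using True face_subset_nb[OF F(1,2)] by auto
          ultimately have "F = insert u (nb u - G)" using F(3) by (intro card_subset_eq) auto
          then show ?thesis by simp
        next
          case False
          then show ?thesis using sub F by auto
        qed
      qed
      then have "card (star 3 u) \<le> card (insert (insert u (nb u - G)) {F. F \<subseteq> G \<and> u \<in> F \<and> card F = 3})"
        using fin_inG by (intro card_mono) auto
      also have "\<dots> \<le> 4" using card_inG fin_inG by (simp add: card_insert_if)
      finally show False using star3 by simp
    qed
  qed
  have "(\<Sum>x\<in>nb u. pay u x) = (\<Sum>x\<in>G - {u}. pay u x)"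
    using outside Gn by (intro sum.mono_neutral_right) auto
  also have "\<dots> \<le> (\<Sum>x\<in>G - {u}. 2)" by (rule sum_mono) (use inside in auto)
  also have "\<dots> = 6" using cardG by simp
  finally show ?thesis .
qed

text \<open>The slack is exactly 120 + 120 + 30 - 258 = 12. It suffices that each payment is at most
  twice the codegree in size 4, since these codegrees sum to 6.\<close>

lemma load_4_6_2:
  assumes nb4: "card (nb u) = 4" and star3: "card (star 3 u) = 6" and star4: "card (star 4 u) = 2"
  shows "(\<Sum>x\<in>nb u. pay u x) \<le> 12"
proof -
  have "pay u x \<le> 2 * codeg 4 u x" if x: "x \<in> nb u" for x
  proof -
    have "(\<Sum>y\<in>nb u. codeg 3 u y) = codeg 3 u x + (\<Sum>y\<in>nb u - {x}. codeg 3 u y)"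
      using x by (intro sum.remove) auto
    also have "(\<Sum>y\<in>nb u - {x}. codeg 3 u y) \<le> (\<Sum>y\<in>nb u - {x}. 3)"
      using codeg3_le[of _ u] nb4 by (intro sum_mono) fastforce
    also have "\<dots> = 9" using nb4 x by simp
    finally have c3: "codeg 3 u x \<noteq> 2" using sum_codeg3[of u] star3 by simp
    \<comment> \<open>Without \<open>x\<close> there are only three neighbours left, too few for two
      faces of size 4.\<close>
    have "codeg 4 u x \<noteq> 0"
    proof
      assume "codeg 4 u x = 0"
      then have "x \<notin> F" if "F \<in> star 4 u" for F
        using codeg_pos[of F u x 4] that by (auto simp: star_def)
      then have "star 4 u \<subseteq> {F. F \<subseteq> insert u (nb u - {x}) \<and> u \<in> F \<and> card F = 4}"
        using star_subset[of 4 u] by blast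
      moreover have "finite {F. F \<subseteq> insert u (nb u - {x}) \<and> u \<in> F \<and> card F = 4}"
        by (rule finite_subset[of _ "Pow (insert u (nb u))"]) auto
      ultimately have "card (star 4 u) \<le> card {F. F \<subseteq> insert u (nb u - {x}) \<and> u \<in> F \<and> card F = 4}"
        by (intro card_mono)
      also have "\<dots> = 1"
        using card_subsets_containing[of "insert u (nb u - {x})" u 3] nb4 x by simp
      finally show False using star4 by simp
    qed
    then show ?thesis using pay_bounds(5)[OF x] c3 by simp
  qed
  then have "(\<Sum>x\<in>nb u. pay u x) \<le> (\<Sum>x\<in>nb u. 2 * codeg 4 u x)" by (rule sum_mono)
  also have "\<dots> = 12" using sum_codeg4[of u] star4 by (simp flip: sum_distrib_left)
  finally show ?thesis .
qed

lemma codeg4_eq_0: "card (star 4 u) = 0 \<Longrightarrow> codeg 4 u x = 0"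
  using codeg_le_star[of 4 u x] by simp

lemma load_le:
  shows "(\<Sum>x\<in>nb u. pay u x) \<le> 4 * card (nb u)"
    "(\<Sum>x\<in>nb u. pay u x) \<le> 4 * card (star 3 u)"
    "card (star 4 u) = 0 \<Longrightarrow> (\<Sum>x\<in>nb u. pay u x) \<le> 2 * card (star 3 u)"
proof -
  show "(\<Sum>x\<in>nb u. pay u x) \<le> 4 * card (nb u)"
    using sum_bounded_above[of "nb u" "pay u" 4] pay_bounds(1) by simp
  have "(\<Sum>x\<in>nb u. pay u x) \<le> (\<Sum>x\<in>nb u. 2 * codeg 3 u x)"
    using pay_bounds(2) by (rule sum_mono)
  then show "(\<Sum>x\<in>nb u. pay u x) \<le> 4 * card (star 3 u)"
    using sum_codeg3[of u] by (simp flip: sum_distrib_left)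
  assume "card (star 4 u) = 0"
  then have "(\<Sum>x\<in>nb u. pay u x) \<le> (\<Sum>x\<in>nb u. codeg 3 u x)"
    using pay_bounds(3) codeg4_eq_0 by (intro sum_mono) auto
  then show "(\<Sum>x\<in>nb u. pay u x) \<le> 2 * card (star 3 u)"
    using sum_codeg3[of u] by simp
qed

text \<open>Here 258 is 318 less the 60 for the singleton. The general bounds in
  \<open>load_le\<close> suffice except for the counts treated in \<open>load_5_5_1\<close> and
  \<open>load_4_6_2\<close>.\<close>

lemma load_capacity:
  assumes "u \<in> vertices S" "\<not> isA u" "\<not> isB u"
  shows "(\<Sum>x\<in>nb u. pay u x) + 258 \<le> 30 * card (nb u) + 20 * card (star 3 u) + 15 * card (star 4 u)"
proof -
  define v e t p where "v = card (nb u)" and "e = card (star 3 u)" and "t = card (star 4 u)"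
    and "p = (\<Sum>x\<in>nb u. pay u x)"
  note defs = v_def e_def t_def p_def
  have deg: "4 \<le> v \<and> 6 \<le> e \<and> 4 \<le> t \<or> 11 \<le> v + e + t"
    using big_face_or_degree[OF assms(1)] by (simp add: defs)
  have e3: "0 < t \<Longrightarrow> 3 \<le> e" and e5: "2 \<le> t \<Longrightarrow> 5 \<le> e"
    using star3_ge_3 star3_ge_5 by (auto simp: defs)
  have ev: "e \<le> v choose 2" and tv: "t \<le> v choose 3"
    using card_star_le[of 2 u] card_star_le[of 3 u] by (simp_all add: defs)
  have notA: "\<not> (v = 4 \<and> e = 5 \<and> 2 \<le> t)" and notB: "\<not> (v = 4 \<and> e = 6 \<and> t = 1)"
    using assms(2,3) by (auto simp: defs isA_iff_numbers isB_iff_numbers)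
  have pv: "p \<le> 4 * v" and pe: "p \<le> 4 * e" and p0: "t = 0 \<Longrightarrow> p \<le> 2 * e"
    using load_le[of u] by (simp_all add: defs)
  have p551: "v = 5 \<Longrightarrow> e = 5 \<Longrightarrow> t = 1 \<Longrightarrow> p \<le> 6"
    using load_5_5_1[of u] by (simp add: defs)
  have p462: "v = 4 \<Longrightarrow> e = 6 \<Longrightarrow> t = 2 \<Longrightarrow> p \<le> 12"
    using load_4_6_2[of u] by (simp add: defs)
  consider "v \<le> 3" | "v = 4" | "v = 5" | "6 \<le> v" by linarith
  then have "p + 258 \<le> 30 * v + 20 * e + 15 * t"
  proof cases
    case 1
    have "3 choose 2 = (3::nat)" by (simp add: eval_nat_numeral)
    then have "e \<le> 3" "t \<le> 1"
      using binomial_right_mono[OF 1, of 2] binomial_right_mono[OF 1, of 3] ev tv by simp_all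
    then show ?thesis using deg 1 by linarith
  next
    case 2
    then have "e \<le> 6" using ev by (simp add: eval_nat_numeral)
    \<comment> \<open>Once types A and B are excluded, \<open>e = 6\<close> and
      \<open>t \<ge> 2\<close> remain; from \<open>t = 3\<close> on the slack is at least 27, and
      the load at most 16.\<close>
    then show ?thesis using 2 deg e5 notA notB pv p462 by linarith
  next
    case 3
    \<comment> \<open>The tight case is \<open>e = 6\<close>, \<open>t = 0\<close>: the slack 150 +
      120 - 258 = 12 equals \<open>2 * e\<close>.\<close>
    then show ?thesis using deg e3 e5 pv p551 p0 by linarith
  next
    case 4
    then show ?thesis using deg e3 e5 pv pe by linarith
  qed
  then show ?thesis by (simp add: defs)
qed

lemma balance:
  assumes "u \<in> vertices S"
  shows "(\<Sum>x\<in>nb u. pay u x) + 258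
    \<le> 30 * card (nb u) + 20 * card (star 3 u) + 15 * card (star 4 u) + (\<Sum>x\<in>nb u. pay x u)"
proof -
  consider "isA u" | "isB u" | "\<not> isA u" "\<not> isB u" by blast
  then show ?thesis
  proof cases
    case 1
    then show ?thesis using isA_pays_0[OF 1] received_A[OF 1] by (simp add: isA_iff_numbers)
  next
    case 2
    then show ?thesis using isB_pays_0[OF 2] received_B[OF 2] by (simp add: isB_iff_numbers)
  next
    case 3
    then show ?thesis using load_capacity[OF assms 3] by simp
  qed
qed

section \<open>Summation over all vertices and the lower bound on the number of faces\<close>

lemma sum_pay_swap: "(\<Sum>u\<in>vertices S. \<Sum>x\<in>nb u. pay u x) = (\<Sum>u\<in>vertices S. \<Sum>x\<in>nb u. pay x u)"
proof -
  have nb: "nb u = {x \<in> vertices S. x \<in> nb u}" "nb u = {x \<in> vertices S. u \<in> nb x}" for u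
    using nb_subset nb_sym by auto
  have "(\<Sum>u\<in>vertices S. \<Sum>x\<in>nb u. pay u x)
      = (\<Sum>u\<in>vertices S. \<Sum>x | x \<in> vertices S \<and> x \<in> nb u. pay u x)"
    by (intro sum.cong refl nb(1))
  also have "\<dots> = (\<Sum>x\<in>vertices S. \<Sum>u | u \<in> vertices S \<and> x \<in> nb u. pay u x)"
    by (rule sum.swap_restrict[OF finite_vertices finite_vertices])
  also have "\<dots> = (\<Sum>x\<in>vertices S. \<Sum>u\<in>nb x. pay u x)"
    by (intro sum.cong refl nb(2)[symmetric])
  finally show ?thesis .
qed

lemma sum_card_star: "(\<Sum>u\<in>vertices S. card (star k u)) = k * card {F \<in> S. card F = k}"
proof -
  have "(\<Sum>u\<in>vertices S. card {F \<in> {F \<in> S. card F = k}. u \<in> F}) = k * card {F \<in> S. card F = k}"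
  proof (rule sum_multicount)
    have "{u \<in> vertices S. u \<in> F} = F" if "F \<in> S" for F
      using that by (auto simp: vertices_def)
    then show "\<forall>F\<in>{F \<in> S. card F = k}. card {u \<in> vertices S. u \<in> F} = k" by auto
  qed (use finite_S finite_vertices in auto)
  moreover have "{F \<in> {F \<in> S. card F = k}. u \<in> F} = star k u" for u
    by (auto simp: star_def)
  ultimately show ?thesis by simp
qed

text \<open>Payments cancel in the sum. The weights 30, 20, 15 are 60 divided by the size, so each
  face of size 2, 3, 4 is counted 60 times in total. The singletons raise 258 to 318 per vertex, and
  the empty face adds the final 60, which makes the bound strict.\<close>

lemma card_faces_ge: "318 * card (vertices S) + 60 \<le> 60 * card S"
proof -
  define f where "f k = card {F \<in> S. card F = k}" for k
  have star_sum: "(\<Sum>u\<in>vertices S. card (star k u)) = k * f k" for k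
    using sum_card_star by (simp add: f_def)
  have "star 1 u = {{u}}" if "u \<in> vertices S" for u
    using that face_subset by (auto simp: star_def vertices_def card_1_singleton_iff)
  then have f1: "f 1 = card (vertices S)" using star_sum[of 1] by simp
  have "{} \<in> S" using complex by (auto simp: simplicial_complex_def)
  then have "{F \<in> S. card F = 0} = {{}}" using finite_face by auto
  then have f0: "f 0 = 1" by (simp add: f_def)
  \<comment> \<open>Faces of size 5 or more are dropped; they only increase
    \<open>card S\<close>.\<close>
  have "(\<Sum>k<5. f k) = card (\<Union>k<5. {F \<in> S. card F = k})"
    unfolding f_def using finite_S by (subst card_UN_disjoint) auto
  also have "\<dots> \<le> card S" using finite_S by (intro card_mono) auto
  finally have S: "1 + card (vertices S) + f 2 + f 3 + f 4 \<le> card S"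
    using f0 f1 by (simp add: eval_nat_numeral)
  have "(\<Sum>u\<in>vertices S. (\<Sum>x\<in>nb u. pay u x) + 258)
    \<le> (\<Sum>u\<in>vertices S. 30 * card (star 2 u) + 20 * card (star 3 u) + 15 * card (star 4 u)
        + (\<Sum>x\<in>nb u. pay x u))"
    using balance by (intro sum_mono) (simp add: card_star2)
  then have "258 * card (vertices S) \<le> 30 * (2 * f 2) + 20 * (3 * f 3) + 15 * (4 * f 4)"
    using sum_pay_swap by (simp add: sum.distrib star_sum flip: sum_distrib_left)
  then show ?thesis using S by linarith
qed

end

lemma alpha_bound_11: "alpha_bound 11 (53 / 10)"
  unfolding alpha_bound_def
proof (intro allI impI, rule ccontr)
  fix S :: "nat set set"
  assume S: "simplicial_complex S" and le: "real (card S) \<le> 53 / 10 * real (card (vertices S))"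
    and deg: "\<not> min_degree S \<le> enat 11"
  have "12 \<le> vertex_degree S x" if "x \<in> vertices S" for x
  proof -
    have "min_degree S \<le> enat (vertex_degree S x)"
      unfolding min_degree_def using that by (rule INF_lower)
    then have "enat 11 < enat (vertex_degree S x)" using deg by (metis leI order_trans)
    then show ?thesis by simp
  qed
  then interpret min_degree_12 S using S by unfold_locales
  have "real (318 * card (vertices S) + 60) \<le> real (60 * card S)"
    using card_faces_ge by (rule of_nat_mono)
  then show False using le by simp
qed

subsection \<open>Extremal complexes\<close>

definition block :: "nat set set" where
  "block = insert {1, 2, 3, 4} {F. F \<subseteq> {..<5} \<and> card F \<le> 3}"

text \<open>First components label the blocks. Blocks are joined only in pairs \<open>2 * j\<close>,
  \<open>2 * j + 1\<close>, and the empty face is split off so that it is counted once.\<close>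

definition chained_blocks :: "nat \<Rightarrow> (nat \<times> nat) set set" where
  "chained_blocks m = insert {} ((\<Union>i<2 * m. (`) (Pair i) ` (block - {{}}))
     \<union> (\<lambda>j. {(2 * j, 0), (2 * j + 1, 0)}) ` {..<m})"

lemma block_subset: "F \<in> block \<Longrightarrow> F \<subseteq> {..<5}"
  unfolding block_def by (elim insertE CollectE conjE) simp_all

lemma finite_block: "finite block"
  by (rule finite_subset[of _ "Pow {..<5}"]) (use block_subset in blast, simp)

lemma block_down:
  assumes "F \<in> block" "G \<subseteq> F"
  shows "G \<in> block"
proof -
  have fin: "finite F" using block_subset[OF assms(1)] finite_subset by blast
  have "G \<subseteq> {..<5}" using assms block_subset by blast
  moreover have "card G \<le> 3 \<or> G = F"
  proof (rule disjCI)
    assume "G \<noteq> F"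
    then have "card G < card F" using assms(2) fin psubset_card_mono by blast
    then show "card G \<le> 3" using assms(1) by (auto simp: block_def)
  qed
  ultimately show ?thesis using assms(1) by (auto simp: block_def)
qed

lemma singleton_block: "k < 5 \<Longrightarrow> {k} \<in> block"
  by (simp add: block_def)

lemma card_block_le: "card (block - {{}}) \<le> 26"
proof -
  have "block - {{}} \<subseteq> insert {1, 2, 3, 4} (\<Union>k\<in>{1, 2, 3}. {F. F \<subseteq> {..<5} \<and> card F = k})"
  proof
    fix F assume F: "F \<in> block - {{}}"
    then have "finite F" using block_subset finite_subset by blast
    then have "card F \<noteq> 0" using F by auto
    then have "card F \<le> 3 \<Longrightarrow> card F = 1 \<or> card F = 2 \<or> card F = 3" by linarith
    then show "F \<in> insert {1, 2, 3, 4} (\<Union>k\<in>{1, 2, 3}. {F. F \<subseteq> {..<5} \<and> card F = k})"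
      using F by (auto simp: block_def)
  qed
  then have "card (block - {{}}) \<le> card (insert {1, 2, 3, 4} (\<Union>k\<in>{1, 2, 3}. {F. F \<subseteq> {..<5::nat} \<and> card F = k}))"
    by (intro card_mono) auto
  also have "\<dots> \<le> Suc (card (\<Union>k\<in>{1, 2, 3}. {F. F \<subseteq> {..<5::nat} \<and> card F = k}))"
    by (rule card_insert_le_m1[THEN order_trans]) auto
  also have "\<dots> \<le> Suc (\<Sum>k\<in>{1, 2, 3}. card {F. F \<subseteq> {..<5::nat} \<and> card F = k})"
    by (intro Suc_le_mono[THEN iffD2] card_UN_le) auto
  \<comment> \<open>The set of size 4, and 5 + 10 + 10 sets of sizes 1, 2, 3.\<close>
  also have "\<dots> = 26" by (simp add: n_subsets) (simp add: eval_nat_numeral)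
  finally show ?thesis .
qed

text \<open>A point lies in 1 + 4 + 6 sets of size at most 3, and each point except \<open>0\<close>
  also in \<open>{1, 2, 3, 4}\<close>.\<close>

lemma block_degree:
  assumes "k < 5"
  shows "(if k = 0 then 11 else 12) \<le> card {F \<in> block. k \<in> F}"
proof -
  let ?X = "\<Union>j\<in>{0, 1, 2}. {F. F \<subseteq> {..<5::nat} \<and> k \<in> F \<and> card F = Suc j}"
  have X: "card ?X = 11"
  proof -
    have "card ?X = (\<Sum>j\<in>{0, 1, 2}. card {F. F \<subseteq> {..<5::nat} \<and> k \<in> F \<and> card F = Suc j})"
      by (rule card_UN_disjoint) auto
    also have "\<dots> = 11"
      using assms by (simp add: card_subsets_containing) (simp add: eval_nat_numeral)
    finally show ?thesis .
  qed
  have sub: "?X \<subseteq> {F \<in> block. k \<in> F}" by (auto simp: block_def)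
  have fin: "finite {F \<in> block. k \<in> F}" using finite_block by simp
  show ?thesis
  proof (cases "k = 0")
    case True
    then show ?thesis using card_mono[OF fin sub] X by simp
  next
    case False
    then have "k = 1 \<or> k = 2 \<or> k = 3 \<or> k = 4" using assms by linarith
    then have "{1, 2, 3, 4} \<in> {F \<in> block. k \<in> F}" by (auto simp: block_def)
    moreover have "{1, 2, 3, 4} \<notin> ?X" by simp
    ultimately have "card (insert {1, 2, 3, 4} ?X) \<le> card {F \<in> block. k \<in> F}"
      using sub by (intro card_mono[OF fin]) auto
    moreover have "finite ?X" using fin sub finite_subset by blast
    ultimately show ?thesis using X False \<open>{1, 2, 3, 4} \<notin> ?X\<close> by simp
  qed
qed

lemma chained_blocks_mem:
  "i < 2 * m \<Longrightarrow> F \<in> block \<Longrightarrow> Pair i ` F \<in> chained_blocks m"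
  unfolding chained_blocks_def by (cases "F = {}") (simp, blast)

lemma chained_blocks_cases:
  assumes "A \<in> chained_blocks m"
  obtains "A = {}" | i F where "i < 2 * m" "F \<in> block" "A = Pair i ` F"
    | j where "j < m" "A = {(2 * j, 0), (2 * j + 1, 0)}"
proof -
  have "A = {} \<or> (\<exists>i<2 * m. \<exists>F\<in>block. A = Pair i ` F) \<or> (\<exists>j<m. A = {(2 * j, 0), (2 * j + 1, 0)})"
    using assms unfolding chained_blocks_def by blast
  then show thesis using that by metis
qed

lemma finite_chained_blocks: "finite (chained_blocks m)"
  unfolding chained_blocks_def using finite_block by simp

lemma chained_blocks_complex: "simplicial_complex (chained_blocks m)"
  unfolding simplicial_complex_def
proof (intro conjI ballI allI impI)
  show "chained_blocks m \<noteq> {}" by (simp add: chained_blocks_def)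
  show "finite (chained_blocks m)" by (rule finite_chained_blocks)
  show "finite A" if "A \<in> chained_blocks m" for A
    using that
    by (cases rule: chained_blocks_cases) (auto intro: finite_subset[OF block_subset])
  fix A B assume A: "A \<in> chained_blocks m" and B: "B \<subseteq> A"
  from A show "B \<in> chained_blocks m"
  proof (cases rule: chained_blocks_cases)
    case 1
    then show ?thesis using B A by simp
  next
    case (2 i F)
    then obtain G where "G \<subseteq> F" "B = Pair i ` G" using B by (meson subset_imageE)
    then show ?thesis using chained_blocks_mem block_down 2 by blast
  next
    case (3 j)
    have "B = {} \<or> B = Pair (2 * j) ` {0} \<or> B = Pair (2 * j + 1) ` {0} \<or> B = A"
      using B 3(2) by auto
    moreover have "Pair (2 * j) ` {0} \<in> chained_blocks m" "Pair (2 * j + 1) ` {0} \<in> chained_blocks m"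
      using 3(1) by (intro chained_blocks_mem singleton_block; simp)+
    moreover have "{} \<in> chained_blocks m" by (simp add: chained_blocks_def)
    ultimately show ?thesis using A by metis
  qed
qed

lemma vertices_chained_blocks: "vertices (chained_blocks m) = {..<2 * m} \<times> {..<5}"
proof
  show "vertices (chained_blocks m) \<subseteq> {..<2 * m} \<times> {..<5}"
  proof
    fix p assume "p \<in> vertices (chained_blocks m)"
    then obtain A where "A \<in> chained_blocks m" "p \<in> A" by (auto simp: vertices_def)
    then show "p \<in> {..<2 * m} \<times> {..<5}"
      by (cases rule: chained_blocks_cases) (auto dest: block_subset)
  qed
  show "{..<2 * m} \<times> {..<5} \<subseteq> vertices (chained_blocks m)"
  proof clarify
    fix i k :: nat assume "i < 2 * m" "k < 5"
    then have "Pair i ` {k} \<in> chained_blocks m" by (intro chained_blocks_mem singleton_block)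
    then show "(i, k) \<in> vertices (chained_blocks m)" by (auto simp: vertices_def)
  qed
qed

text \<open>Each pair of blocks has at most 26 + 26 nonempty faces and one joining edge; the last 1
  is the empty face.\<close>

lemma card_chained_blocks_le: "card (chained_blocks m) \<le> 53 * m + 1"
proof -
  have "card (\<Union>i<2 * m. (`) (Pair i) ` (block - {{}})) \<le> (\<Sum>i<2 * m. card ((`) (Pair i) ` (block - {{}})))"
    by (rule card_UN_le) simp
  also have "\<dots> \<le> (\<Sum>i<2 * m. 26)"
    using finite_block by (intro sum_mono order_trans[OF card_image_le card_block_le]) simp
  finally have "card (\<Union>i<2 * m. (`) (Pair i) ` (block - {{}})) \<le> 52 * m" by simp
  moreover have "card ((\<lambda>j. {(2 * j, 0::nat), (2 * j + 1, 0)}) ` {..<m}) \<le> m"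
    using card_image_le[of "{..<m}"] by simp
  ultimately have "card ((\<Union>i<2 * m. (`) (Pair i) ` (block - {{}}))
      \<union> (\<lambda>j. {(2 * j, 0), (2 * j + 1, 0)}) ` {..<m}) \<le> 53 * m"
    by (intro order_trans[OF card_Un_le]) linarith
  then show ?thesis
    unfolding chained_blocks_def by (simp add: card_insert_if finite_block)
qed

lemma chained_blocks_degree:
  assumes "p \<in> vertices (chained_blocks m)"
  shows "12 \<le> vertex_degree (chained_blocks m) p"
proof -
  obtain i k where ik: "p = (i, k)" by (cases p)
  then have p: "p = (i, k)" "i < 2 * m" "k < 5"
    using assms by (simp_all add: vertices_chained_blocks)
  let ?X = "(`) (Pair i) ` {F \<in> block. k \<in> F}"
  have sub: "?X \<subseteq> {e \<in> chained_blocks m. p \<in> e}"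
    using chained_blocks_mem[OF p(2)] p(1) by auto
  have fin: "finite {e \<in> chained_blocks m. p \<in> e}" using finite_chained_blocks by simp
  have "inj_on ((`) (Pair i)) {F \<in> block. k \<in> F}"
    by (rule inj_onI) (simp add: inj_image_eq_iff inj_on_def)
  then have card: "(if k = 0 then 11 else 12) \<le> card ?X"
    using block_degree[OF p(3)] by (simp add: card_image)
  show ?thesis
  proof (cases "k = 0")
    case True
    \<comment> \<open>The edge joining the block \<open>i\<close> to its partner;
      \<open>i div 2\<close> is the index of the pair.\<close>
    define e where "e = {(2 * (i div 2), 0::nat), (2 * (i div 2) + 1, 0)}"
    have "i = 2 * (i div 2) \<or> i = 2 * (i div 2) + 1" by linarith
    then have "p \<in> e" using p(1) True by (auto simp: e_def)
    moreover have "e \<in> chained_blocks m"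
    proof -
      have "i div 2 < m" using p(2) by linarith
      then show ?thesis unfolding chained_blocks_def e_def by blast
    qed
    ultimately have "insert e ?X \<subseteq> {e \<in> chained_blocks m. p \<in> e}" using sub by simp
    then have le: "card (insert e ?X) \<le> vertex_degree (chained_blocks m) p"
      unfolding vertex_degree_def by (rule card_mono[OF fin])
    \<comment> \<open>The edge has points in two blocks, so it is new among the faces counted so
      far.\<close>
    have "e \<notin> ?X"
    proof
      assume "e \<in> ?X"
      then obtain F where "e = Pair i ` F" by blast
      then have "fst q = i" if "q \<in> e" for q using that by auto
      from this[of "(2 * (i div 2), 0)"] this[of "(2 * (i div 2) + 1, 0)"] show False
        by (simp add: e_def)
    qed
    moreover have "finite ?X" using finite_block by simp
    ultimately show ?thesis using le card True by simp
  next
    case False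
    then show ?thesis
      using card_mono[OF fin sub] card by (simp add: vertex_degree_def)
  qed
qed

lemma alpha_bound_11_le:
  assumes "alpha_bound 11 a"
  shows "a \<le> 53 / 10"
proof (rule ccontr)
  assume "\<not> a \<le> 53 / 10"
  then have "0 < 10 * a - 53" by simp
  \<comment> \<open>Each pair of blocks gains \<open>10 * a - 53\<close>; enough pairs make up for
    the one empty face.\<close>
  then obtain m where "1 < real m * (10 * a - 53)" using reals_Archimedean3 by blast
  then have "real (53 * m + 1) \<le> a * real (10 * m)" by (simp add: algebra_simps)
  moreover have "card (vertices (chained_blocks m)) = 10 * m"
    by (simp add: vertices_chained_blocks card_cartesian_product)
  moreover have "real (card (chained_blocks m)) \<le> real (53 * m + 1)"
    using card_chained_blocks_le by (rule of_nat_mono)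
  ultimately have "real (card (chained_blocks m)) \<le> a * real (card (vertices (chained_blocks m)))"
    by simp
  then have "min_degree (chained_blocks m) \<le> enat 11"
    using assms chained_blocks_complex by (intro alpha_bound_any_type)
  moreover have "enat 12 \<le> min_degree (chained_blocks m)"
    unfolding min_degree_def by (rule INF_greatest) (simp add: chained_blocks_degree)
  ultimately have "enat 12 \<le> enat 11" by (rule order_trans[rotated])
  then show False by simp
qed

theorem theorem1p2: "alpha 11 = 53 / 10"
  unfolding alpha_def
proof (rule Greatest_equality)
  show "alpha_bound 11 (53 / 10)" by (rule alpha_bound_11)
  show "a \<le> 53 / 10" if "alpha_bound 11 a" for a using that by (rule alpha_bound_11_le)
qed

end
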